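(* Consider a process described by a family of completely positive trace preserving (CPTP) maps $\{\Phi_t\}_t$ acting on Alice's system, and let $t\geq s$. If either the Schrödinger propagator $\Phi^S_{t,s}$ or the Heisenberg propagator ${\Phi^H_{t,s}}^*$ is completely positive, then $$S(\Phi_t)\leq S(\Phi_s),$$ where $S(\Phi)$ denotes the optimal Bell-CHSH parameter of the channel $\Phi$.
   Context: Alice and Bob share a bipartite quantum state; noise acts only on Alice's half. For a CPTP map $\Phi$ on Alice's system, $\Phi^*$ denotes its adjoint (Heisenberg picture) map, $\operatorname{tr}[\Phi^*[X]\rho]=\operatorname{tr}[X\,\Phi[\rho]]$, which is completely positive and unital. A binary measurement with outcomes $\pm1$ (two-outcome POVM $\{M_+,M_-\}$) is represented by the operator $A=M_+-M_-$. For a bipartite state $\rho$ and binary measurements $A,A'$ of Alice and $B,B'$ of Bob, put $\langle AB\rangle_\rho=\operatorname{tr}[(A\otimes B)\rho]$ and $$S_{A,A',B,B'}(\rho)=\left|\langle AB\rangle_\rho+\langle AB'\rangle_\rho+\langle A'B\rangle_\rho-\langle A'B'\rangle_\rho\right|.$$ The optimal Bell-CHSH parameter of a channel $\Phi$ acting on Alice's side is $$S(\Phi)=\max_\rho\max_{A,A',B,B'}S_{\Phi^*[A],\Phi^*[A'],B,B'}(\rho),$$ the maxima being over all bipartite states $\rho$ and all binary measurements $A,A'$ of Alice and $B,B'$ of Bob. Propagators: for $s\leq t$, the Schrödinger propagator $\Phi^S_{t,s}$ is the map obeying $\Phi_t=\Phi^S_{t,s}\circ\Phi_s$, and the Heisenberg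 propagator ${\Phi^H_{t,s}}^*$ is the map obeying $\Phi_t^*={\Phi^H_{t,s}}^*\circ\Phi_s^*$. If the dynamics is invertible at time $s$, they are given by $\Phi^S_{t,s}=\Phi_t\circ\Phi_s^{-1}$ and ${\Phi^H_{t,s}}^*=\Phi_t^*\circ(\Phi_s^* )^{-1}$. Although $\Phi_s$ and $\Phi_t$ are completely positive, the propagators need not be.
   Formalization: Systems are finite-dimensional. A Schrödinger propagator is also required to be trace preserving: automatic if the dynamics is invertible at time s, but otherwise a CP map with Φ_t = Φ^S∘Φ_s need not preserve trace and the inequality can fail. *)

theory Defs
  imports "HOL-Analysis.Analysis"
begin

text \<open>
  A finite-dimensional system is a finite index type: operators on it are the complex square matrices
  indexed by that type, and the composite of the systems \<open>'a\<close> and \<open>'b\<close> is indexed by \<open>'a \<times> 'b\<close>.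
\<close>

type_synonym 'a operator = "complex ^ 'a ^ 'a"

type_synonym 'a superop = "'a operator \<Rightarrow> 'a operator"

definition kron :: "'a::finite operator \<Rightarrow> 'b::finite operator \<Rightarrow> ('a \<times> 'b) operator" where
  "kron A B = (\<chi> p q. A $ fst p $ fst q * B $ snd p $ snd q)"

definition cscale :: "complex \<Rightarrow> 'a::finite operator \<Rightarrow> 'a operator" where
  "cscale c X = (\<chi> i j. c * X $ i $ j)"

definition sesq :: "complex ^ 'a \<Rightarrow> 'a::finite operator \<Rightarrow> complex ^ 'a \<Rightarrow> complex" where
  "sesq v A w = (\<Sum>i\<in>UNIV. \<Sum>j\<in>UNIV. cnj (v $ i) * A $ i $ j * w $ j)"

definition psd :: "'a::finite operator \<Rightarrow> bool" where
  "psd A \<longleftrightarrow> (\<forall>v. sesq v A v \<in> \<real>\<^sub>\<ge>\<^sub>0)"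

text \<open>
  Positivity of the \<open>n \<times> n\<close> block operator with blocks \<open>X i j\<close>, that is of
  \<open>\<Sum>i j. |i\<rangle>\<langle>j| \<otimes> X i j\<close>. The ancilla dimension \<open>n\<close> is a natural number rather than a type
  because complete positivity quantifies over it.
\<close>

definition block_psd :: "nat \<Rightarrow> (nat \<Rightarrow> nat \<Rightarrow> 'a::finite operator) \<Rightarrow> bool" where
  "block_psd n X \<longleftrightarrow>
     (\<forall>v :: nat \<Rightarrow> complex ^ 'a. (\<Sum>i<n. \<Sum>j<n. sesq (v i) (X i j) (v j)) \<in> \<real>\<^sub>\<ge>\<^sub>0)"

definition clinear_map :: "'a::finite superop \<Rightarrow> bool" where
  "clinear_map \<Lambda> \<longleftrightarrow>
     (\<forall>X Y. \<Lambda> (X + Y) = \<Lambda> X + \<Lambda> Y) \<and> (\<forall>c X. \<Lambda> (cscale c X) = cscale c (\<Lambda> X))"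

definition completely_positive :: "'a::finite superop \<Rightarrow> bool" where
  "completely_positive \<Lambda> \<longleftrightarrow>
     clinear_map \<Lambda> \<and> (\<forall>n X. block_psd n X \<longrightarrow> block_psd n (\<lambda>i j. \<Lambda> (X i j)))"

definition trace_preserving :: "'a::finite superop \<Rightarrow> bool" where
  "trace_preserving \<Lambda> \<longleftrightarrow> (\<forall>X. trace (\<Lambda> X) = trace X)"

definition cptp :: "'a::finite superop \<Rightarrow> bool" where
  "cptp \<Lambda> \<longleftrightarrow> completely_positive \<Lambda> \<and> trace_preserving \<Lambda>"

definition heis :: "'a::finite superop \<Rightarrow> 'a superop" where
  "heis \<Lambda> = (THE \<Psi>. \<forall>X \<rho>. trace (\<Psi> X ** \<rho>) = trace (X ** \<Lambda> \<rho>))"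

definition density :: "'a::finite operator \<Rightarrow> bool" where
  "density \<rho> \<longleftrightarrow> psd \<rho> \<and> trace \<rho> = 1"

definition binary_measurement :: "'a::finite operator \<Rightarrow> bool" where
  "binary_measurement A \<longleftrightarrow>
     (\<exists>Mp Mm. psd Mp \<and> psd Mm \<and> Mp + Mm = mat 1 \<and> A = Mp - Mm)"

definition correl :: "'a::finite operator \<Rightarrow> 'b::finite operator \<Rightarrow> ('a \<times> 'b) operator \<Rightarrow> complex" where
  "correl A B \<rho> = trace (kron A B ** \<rho>)"

definition chsh ::
  "'a::finite operator \<Rightarrow> 'a operator \<Rightarrow> 'b::finite operator \<Rightarrow> 'b operator \<Rightarrow> ('a \<times> 'b) operator \<Rightarrow> real" where
  "chsh A A' B B' \<rho> = cmod (correl A B \<rho> + correl A B' \<rho> + correl A' B \<rho> - correl A' B' \<rho>)"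

text \<open>
  The optimal CHSH parameter, where \<open>'b\<close> is Bob's system. States and binary measurements form
  nonempty compact sets, so for a linear \<open>\<Lambda>\<close> the supremum is a maximum.
\<close>

definition chsh_opt :: "'b::finite itself \<Rightarrow> 'a::finite superop \<Rightarrow> real" where
  "chsh_opt bob \<Lambda> = Sup {chsh (heis \<Lambda> A) (heis \<Lambda> A') B B' \<rho> | A A' (B :: 'b operator) B' \<rho>.
     binary_measurement A \<and> binary_measurement A' \<and>
     binary_measurement B \<and> binary_measurement B' \<and> density \<rho>}"

text \<open>
  The propagators from \<open>s\<close> to \<open>t\<close>, given by their defining equations. If \<open>\<Phi> s\<close> is not invertible,
  the equation does not determine a Schroedinger propagator outside the range of \<open>\<Phi> s\<close>, nor does it
  force trace preservation there; a Schroedinger propagator is a map between states, so trace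
  preservation is part of the notion. If \<open>\<Phi> s\<close> is invertible, it is automatic and the propagator is
  \<open>\<Phi> t \<circ> inv (\<Phi> s)\<close>, see \<open>schroedinger_propagator_invertible\<close> below. A Heisenberg propagator
  is always unital, as \<open>heis (\<Phi> s)\<close> and \<open>heis (\<Phi> t)\<close> are.
\<close>

definition schroedinger_propagator :: "('t \<Rightarrow> 'a::finite superop) \<Rightarrow> 't \<Rightarrow> 't \<Rightarrow> 'a superop \<Rightarrow> bool" where
  "schroedinger_propagator \<Phi> t s V \<longleftrightarrow>
     clinear_map V \<and> trace_preserving V \<and> \<Phi> t = V \<circ> \<Phi> s"

definition heisenberg_propagator :: "('t \<Rightarrow> 'a::finite superop) \<Rightarrow> 't \<Rightarrow> 't \<Rightarrow> 'a superop \<Rightarrow> bool" where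
  "heisenberg_propagator \<Phi> t s W \<longleftrightarrow>
     clinear_map W \<and> heis (\<Phi> t) = W \<circ> heis (\<Phi> s)"

definition matrix_unit :: "'a \<Rightarrow> 'a \<Rightarrow> 'a::finite operator" where
  "matrix_unit k l = (\<chi> i j. if i = k \<and> j = l then 1 else 0)"

lemma trace_mult: "trace (A ** B) = (\<Sum>i\<in>UNIV. \<Sum>j\<in>UNIV. A $ i $ j * B $ j $ i)"
  for A :: "'a::finite operator"
  by (simp add: trace_def matrix_matrix_mult_def)

lemma trace_mult_matrix_unit: "trace (A ** matrix_unit k l) = A $ l $ k"
proof -
  have "trace (A ** matrix_unit k l) =
      (\<Sum>i\<in>UNIV. \<Sum>j\<in>UNIV. if j = k then (if i = l then A $ i $ j else 0) else 0)"
    unfolding trace_mult matrix_unit_def by (intro sum.cong) auto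
  then show ?thesis by simp
qed

lemma trace_mult_eqD:
  assumes "\<And>\<rho>. trace (A ** \<rho>) = trace (B ** \<rho>)"
  shows "A = (B :: 'a::finite operator)"
  using assms[of "matrix_unit _ _"] by (simp add: trace_mult_matrix_unit vec_eq_iff)

lemma clinear_map_sum:
  assumes "clinear_map \<Lambda>"
  shows "\<Lambda> (\<Sum>x\<in>S. f x) = (\<Sum>x\<in>S. \<Lambda> (f x))"
proof -
  have "\<Lambda> 0 + \<Lambda> 0 = \<Lambda> 0"
    using assms unfolding clinear_map_def by (metis add_0)
  then have "\<Lambda> 0 = 0" by simp
  then show ?thesis
    using assms by (induction S rule: infinite_finite_induct) (auto simp: clinear_map_def)
qed

lemma operator_decomp: "\<rho> = (\<Sum>i\<in>UNIV. \<Sum>j\<in>UNIV. cscale (\<rho> $ j $ i) (matrix_unit j i))"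
  for \<rho> :: "'a::finite operator"
proof -
  have "(\<Sum>i\<in>UNIV. \<Sum>j\<in>UNIV. cscale (\<rho> $ j $ i) (matrix_unit j i)) $ k $ l = \<rho> $ k $ l" for k l
  proof -
    have "(\<Sum>i\<in>UNIV. \<Sum>j\<in>UNIV. cscale (\<rho> $ j $ i) (matrix_unit j i)) $ k $ l =
        (\<Sum>i\<in>UNIV. \<Sum>j\<in>UNIV. cscale (\<rho> $ j $ i) (matrix_unit j i) $ k $ l)"
      by simp
    also have "\<dots> = (\<Sum>i\<in>UNIV. \<Sum>j\<in>UNIV. if j = k then (if i = l then \<rho> $ j $ i else 0) else 0)"
      by (intro sum.cong) (auto simp: cscale_def matrix_unit_def)
    finally show ?thesis by simp
  qed
  then show ?thesis unfolding vec_eq_iff by metis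
qed

lemma trace_mult_sum: "trace (A ** (\<Sum>x\<in>S. f x)) = (\<Sum>x\<in>S. trace (A ** f x))"
  for A :: "'a::finite operator"
proof (induction S rule: infinite_finite_induct)
  case (insert x S)
  then show ?case by (simp add: matrix_add_ldistrib trace_add)
qed (simp_all add: trace_mult trace_def)

lemma trace_mult_cscale: "trace (A ** cscale c X) = c * trace (A ** X)"
  by (simp add: trace_mult cscale_def sum_distrib_left mult.left_commute)

lemma heis_trace:
  assumes "clinear_map \<Lambda>"
  shows "trace (heis \<Lambda> X ** \<rho>) = trace (X ** \<Lambda> \<rho>)"
proof -
  define \<Psi> where "\<Psi> X = (\<chi> i j. trace (X ** \<Lambda> (matrix_unit j i)))" for X
  have "trace (X ** \<Lambda> \<rho>) = trace (\<Psi> X ** \<rho>)" for X \<rho>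
  proof -
    have "\<Lambda> \<rho> = (\<Sum>i\<in>UNIV. \<Sum>j\<in>UNIV. cscale (\<rho> $ j $ i) (\<Lambda> (matrix_unit j i)))"
      using assms by (subst operator_decomp) (simp add: clinear_map_sum clinear_map_def)
    then show ?thesis
      by (simp add: trace_mult_sum trace_mult_cscale) (simp add: trace_mult \<Psi>_def mult.commute)
  qed
  then have "\<forall>X \<rho>. trace (\<Psi> X ** \<rho>) = trace (X ** \<Lambda> \<rho>)" by simp
  then have "\<forall>X \<rho>. trace (heis \<Lambda> X ** \<rho>) = trace (X ** \<Lambda> \<rho>)"
    unfolding heis_def
  proof (rule theI[where a = \<Psi>])
    fix \<Psi>' assume "\<forall>X \<rho>. trace (\<Psi>' X ** \<rho>) = trace (X ** \<Lambda> \<rho>)"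
    with \<open>\<forall>X \<rho>. trace (\<Psi> X ** \<rho>) = trace (X ** \<Lambda> \<rho>)\<close> show "\<Psi>' = \<Psi>"
      by (intro ext trace_mult_eqD) simp
  qed
  then show ?thesis by blast
qed

lemma clinear_map_heis:
  assumes "clinear_map \<Lambda>"
  shows "clinear_map (heis \<Lambda>)"
proof -
  have cs: "trace (cscale c A ** B) = c * trace (A ** B)" for c and A B :: "'a operator"
    by (simp add: trace_mult cscale_def sum_distrib_left mult.assoc)
  have ad: "trace ((A + B) ** C) = trace (A ** C) + trace (B ** C)" for A B C :: "'a operator"
    by (simp add: trace_mult sum.distrib distrib_right)
  show ?thesis
    unfolding clinear_map_def
    by (auto intro!: trace_mult_eqD
        simp: heis_trace[OF assms] cs ad)
qed

lemma clinear_map_inv: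
  assumes "clinear_map \<Lambda>" "bij \<Lambda>"
  shows "clinear_map (inv \<Lambda>)"
  unfolding clinear_map_def
proof (intro conjI allI)
  have r: "\<Lambda> (inv \<Lambda> X) = X" and i: "inv \<Lambda> (\<Lambda> X) = X" for X
    using assms(2) by (simp_all add: bij_is_surj surj_f_inv_f bij_is_inj)
  show "inv \<Lambda> (X + Y) = inv \<Lambda> X + inv \<Lambda> Y" for X Y
    using assms(1) unfolding clinear_map_def by (metis r i)
  show "inv \<Lambda> (cscale c X) = cscale c (inv \<Lambda> X)" for c X
    using assms(1) unfolding clinear_map_def by (metis r i)
qed

lemma clinear_map_comp: "clinear_map V \<Longrightarrow> clinear_map W \<Longrightarrow> clinear_map (V \<circ> W)"
  by (simp add: clinear_map_def)

lemma schroedinger_propagator_invertible: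
  assumes "cptp (\<Phi> s)" "cptp (\<Phi> t)" "bij (\<Phi> s)"
  shows "schroedinger_propagator \<Phi> t s V \<longleftrightarrow> V = \<Phi> t \<circ> inv (\<Phi> s)"
proof
  have r: "\<Phi> s (inv (\<Phi> s) X) = X" and i: "inv (\<Phi> s) (\<Phi> s X) = X" for X
    using assms(3) by (simp_all add: bij_is_surj surj_f_inv_f bij_is_inj)
  show "V = \<Phi> t \<circ> inv (\<Phi> s)" if "schroedinger_propagator \<Phi> t s V"
    using that r by (auto simp: schroedinger_propagator_def)
  assume V: "V = \<Phi> t \<circ> inv (\<Phi> s)"
  have "trace (V X) = trace X" for X
    using assms(1,2) r[of X] unfolding V cptp_def trace_preserving_def by (metis comp_apply)
  moreover have "clinear_map V"
    unfolding V using assms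
    by (intro clinear_map_comp clinear_map_inv) (auto simp: cptp_def completely_positive_def)
  moreover have "\<Phi> t = V \<circ> \<Phi> s"
    by (auto simp: V i)
  ultimately show "schroedinger_propagator \<Phi> t s V"
    by (simp add: schroedinger_propagator_def trace_preserving_def)
qed

lemma heisenberg_propagator_invertible:
  assumes "cptp (\<Phi> s)" "cptp (\<Phi> t)" "bij (heis (\<Phi> s))"
  shows "heisenberg_propagator \<Phi> t s W \<longleftrightarrow> W = heis (\<Phi> t) \<circ> inv (heis (\<Phi> s))"
proof
  have r: "heis (\<Phi> s) (inv (heis (\<Phi> s)) X) = X" and i: "inv (heis (\<Phi> s)) (heis (\<Phi> s) X) = X" for X
    using assms(3) by (simp_all add: bij_is_surj surj_f_inv_f bij_is_inj)
  show "W = heis (\<Phi> t) \<circ> inv (heis (\<Phi> s))" if "heisenberg_propagator \<Phi> t s W"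
    using that r by (auto simp: heisenberg_propagator_def)
  assume W: "W = heis (\<Phi> t) \<circ> inv (heis (\<Phi> s))"
  have "clinear_map W"
    unfolding W using assms
    by (intro clinear_map_comp clinear_map_inv clinear_map_heis)
      (auto simp: cptp_def completely_positive_def)
  moreover have "heis (\<Phi> t) = W \<circ> heis (\<Phi> s)"
    by (auto simp: W i)
  ultimately show "heisenberg_propagator \<Phi> t s W"
    by (simp add: heisenberg_propagator_def)
qed

end

theory Submission
  imports Defs
begin

text \<open>
  Either propagator turns every CHSH value attainable after \<open>\<Phi> t\<close> into one attainable after
  \<open>\<Phi> s\<close>. The adjoint of a CPTP Schroedinger propagator is positive and unital, so it can be
  absorbed into Alice's measurements. A completely positive Heisenberg propagator \<open>W\<close> fixes
  the identity; its predual \<open>heis W\<close>, amplified by the identity on Bob's system, is trace preserving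
  and positive (the cone of positive operators is self-dual under the trace pairing), so it can be
  absorbed into the state.
\<close>

subsection \<open>Positive operators\<close>

definition outer :: "complex ^ 'a \<Rightarrow> 'a::finite operator" where
  "outer v = (\<chi> i j. v $ i * cnj (v $ j))"

lemma sesq_add_left: "sesq (u + v) A w = sesq u A w + sesq v A w"
  by (simp add: sesq_def sum.distrib algebra_simps)

lemma sesq_add_right: "sesq w A (u + v) = sesq w A u + sesq w A v"
  by (simp add: sesq_def sum.distrib algebra_simps)

lemma sesq_add: "sesq v (A + B) w = sesq v A w + sesq v B w"
  by (simp add: sesq_def sum.distrib algebra_simps)

lemma sesq_diff: "sesq v (A - B) w = sesq v A w - sesq v B w"
  by (simp add: sesq_def sum_subtractf algebra_simps)

lemma sesq_scale_left: "sesq (c *s v) A w = cnj c * sesq v A w"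
  by (simp add: sesq_def sum_distrib_left mult.assoc)

lemma sesq_scale_right: "sesq v A (c *s w) = c * sesq v A w"
  by (simp add: sesq_def sum_distrib_left mult.left_commute)

lemmas sesq_linear = sesq_add_left sesq_add_right sesq_scale_left sesq_scale_right

lemma sesq_axis_right: "sesq v A (axis j 1) = (\<Sum>i\<in>UNIV. cnj (v $ i) * A $ i $ j)"
proof -
  have "cnj (v $ i) * A $ i $ j' * axis j 1 $ j' = (if j' = j then cnj (v $ i) * A $ i $ j' else 0)"
    for i j'
    by (simp add: axis_def)
  then show ?thesis
    by (simp add: sesq_def)
qed

lemma sesq_axis: "sesq (axis i 1) A (axis j 1) = A $ i $ j"
proof -
  have "cnj (axis i 1 $ i') * A $ i' $ j = (if i' = i then A $ i' $ j else 0)" for i'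
    by (simp add: axis_def)
  then show ?thesis
    by (simp add: sesq_axis_right)
qed

lemma sesq_outer: "sesq u (outer v) w =
    cnj (\<Sum>i\<in>UNIV. cnj (v $ i) * u $ i) * (\<Sum>i\<in>UNIV. cnj (v $ i) * w $ i)"
  by (simp add: sesq_def outer_def sum_product mult.assoc mult.left_commute)

lemma trace_mult_outer: "trace (N ** outer v) = sesq v N v"
  by (simp add: trace_mult sesq_def outer_def mult_ac)

lemma psd_outer: "psd (outer v)"
proof -
  have "cnj z * z \<in> \<real>\<^sub>\<ge>\<^sub>0" for z
    by (simp add: complex_nonneg_Reals_iff)
  then show ?thesis
    unfolding psd_def sesq_outer by blast
qed

lemma psd_add: "psd A \<Longrightarrow> psd B \<Longrightarrow> psd (A + B)"
  by (simp add: psd_def sesq_add nonneg_Reals_add_I)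

text \<open>Polarization over the complex numbers: reality of the form at \<open>v + w\<close>
  cancels the imaginary parts of the two cross terms, reality at \<open>v + \<i> *s w\<close>
  equates their real parts. Hermiticity is thus a consequence of \<open>psd\<close>.\<close>

lemma sesq_cnj:
  assumes "psd A"
  shows "sesq w A v = cnj (sesq v A w)"
proof -
  have q: "Im (sesq u A u) = 0" for u
    using assms by (simp add: psd_def complex_nonneg_Reals_iff)
  have "Im (sesq v A w) + Im (sesq w A v) = 0"
    using q[of "v + w"] q[of v] q[of w] by (simp add: sesq_linear)
  moreover have "Re (sesq v A w) = Re (sesq w A v)"
    using q[of "v + \<i> *s w"] q[of v] q[of w] by (simp add: sesq_linear)
  ultimately show ?thesis
    by (simp add: complex_eq_iff)
qed

lemma psd_diag:
  assumes "psd A"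
  shows "0 \<le> Re (A $ k $ k)" "Im (A $ k $ k) = 0"
  using assms sesq_axis[of k A k] by (metis psd_def complex_nonneg_Reals_iff)+

lemma psd_hermitian: "psd A \<Longrightarrow> A $ j $ i = cnj (A $ i $ j)"
  by (metis sesq_cnj sesq_axis)

lemma psd_diag_zero:
  assumes "psd A" and z: "\<And>i. A $ i $ i = 0"
  shows "A = 0"
proof -
  have "A $ i $ j = 0" for i j
  proof -
    let ?m = "A $ i $ j"
    \<comment> \<open>The coefficient makes both cross terms equal to minus the squared modulus of
      \<open>?m\<close>; with zero diagonal nothing compensates them.\<close>
    let ?v = "axis i 1 + (- cnj ?m) *s axis j 1"
    have "sesq ?v A ?v = - 2 * (?m * cnj ?m)"
      unfolding sesq_linear sesq_axis z psd_hermitian[OF assms(1), of j i] by simp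
    moreover have "0 \<le> Re (sesq ?v A ?v)"
      using assms(1) by (simp add: psd_def complex_nonneg_Reals_iff)
    ultimately have "(cmod ?m)\<^sup>2 \<le> 0"
      by (simp add: complex_norm_square[symmetric])
    then show ?thesis by simp
  qed
  then show ?thesis by (simp add: vec_eq_iff)
qed

text \<open>One step of a Cholesky decomposition: \<open>v\<close> is the k-th column divided by the
  square root of the pivot, so subtracting \<open>outer v\<close> clears the pivot.\<close>

lemma psd_schur_complement:
  assumes M: "psd M" and k: "M $ k $ k \<noteq> 0"
  obtains v where "psd (M - outer v)" "(M - outer v) $ k $ k = 0"
proof -
  define r where "r = Re (M $ k $ k)"
  have r: "r > 0" "M $ k $ k = of_real r"
    using psd_diag[OF M, of k] k by (auto simp: r_def complex_eq_iff order_less_le)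
  define v :: "complex ^ 'a" where "v = (\<chi> i. M $ i $ k / of_real (sqrt r))"
  have sq: "complex_of_real (sqrt r) * complex_of_real (sqrt r) = of_real r"
    using r(1) by (simp flip: of_real_mult)
  have v: "(\<Sum>i\<in>UNIV. cnj (v $ i) * w $ i) = cnj (sesq w M (axis k 1)) / of_real (sqrt r)" for w
    by (simp add: v_def sesq_axis_right sum_divide_distrib mult.commute)
  have "sesq w (M - outer v) w \<in> \<real>\<^sub>\<ge>\<^sub>0" for w
  proof -
    define z where "z = sesq w M (axis k 1)"
    have z': "sesq (axis k 1) M w = cnj z"
      unfolding z_def by (rule sesq_cnj[OF M])
    \<comment> \<open>Completing the square: this multiple of the k-th basis vector minimizes the
      form of \<open>M\<close>, and the minimum is the form of \<open>M - outer v\<close> at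
      \<open>w\<close>.\<close>
    let ?u = "w + (- (cnj z / of_real r)) *s axis k 1"
    have "sesq ?u M ?u = sesq w M w - z * cnj z / of_real r"
      using r(1) unfolding sesq_linear z' z_def[symmetric] sesq_axis r(2)
      by (simp add: field_simps)
    moreover have "sesq w (M - outer v) w = sesq w M w - z * cnj z / of_real r"
      unfolding sesq_diff sesq_outer v z_def[symmetric] by (simp add: sq)
    ultimately show ?thesis
      using M unfolding psd_def by metis
  qed
  moreover have "(M - outer v) $ k $ k = 0"
    using r(1) by (simp add: outer_def v_def r(2) sq)
  ultimately show ?thesis
    using that unfolding psd_def by blast
qed

text \<open>Iterated Cholesky steps write \<open>M\<close> as a finite sum of rank-one operators.
  The number of nonzero diagonal entries drops at each step; once it is zero, \<open>M\<close>
  vanishes by \<open>psd_diag_zero\<close>.\<close>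

lemma psd_induct [consumes 1, case_names zero add]:
  assumes "psd M" and "P 0" and step: "\<And>M v. psd M \<Longrightarrow> P M \<Longrightarrow> P (M + outer v)"
  shows "P M"
  using assms(1)
proof (induction "card {i. M $ i $ i \<noteq> 0}" arbitrary: M rule: less_induct)
  case (less M)
  show ?case
  proof (cases "\<forall>i. M $ i $ i = 0")
    case True
    then show ?thesis
      using psd_diag_zero[OF less.prems] \<open>P 0\<close> by auto
  next
    case False
    then obtain k where k: "M $ k $ k \<noteq> 0" by blast
    obtain v where v: "psd (M - outer v)" "(M - outer v) $ k $ k = 0"
      using psd_schur_complement[OF less.prems k] .
    \<comment> \<open>No new nonzero entry appears: at a zero diagonal entry the remainder is minus
      a squared modulus, yet nonnegative.\<close>
    have "(M - outer v) $ i $ i = 0" if "M $ i $ i = 0" for i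
    proof -
      have "(M - outer v) $ i $ i = - of_real ((cmod (v $ i))\<^sup>2)"
        using that by (simp add: outer_def complex_norm_square[symmetric])
      moreover from this psd_diag(1)[OF v(1), of i] have "(cmod (v $ i))\<^sup>2 \<le> 0"
        by (simp only: uminus_complex.sel Re_complex_of_real)
      ultimately show ?thesis by simp
    qed
    then have "{i. (M - outer v) $ i $ i \<noteq> 0} \<subset> {i. M $ i $ i \<noteq> 0}"
      using k v(2) by auto
    then have "P (M - outer v)"
      by (intro less.hyps v(1) psubset_card_mono) auto
    from step[OF v(1) this, of v] show ?thesis by simp
  qed
qed

text \<open>One half of the self-duality of the positive cone: on a rank-one \<open>N\<close> the
  pairing is the quadratic form of \<open>M\<close>. The other half is \<open>psd_dual\<close>,
  where rank-one tests suffice.\<close>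

lemma trace_mult_psd:
  assumes "psd M" "psd N"
  shows "trace (M ** N) \<in> \<real>\<^sub>\<ge>\<^sub>0"
  using assms(2)
proof (induction N rule: psd_induct)
  case zero
  then show ?case by (simp add: trace_def)
next
  case (add N v)
  then show ?case
    using assms(1) by (simp add: matrix_add_ldistrib trace_add trace_mult_outer psd_def nonneg_Reals_add_I)
qed

lemma psd_dual:
  assumes "\<And>N. psd N \<Longrightarrow> trace (M ** N) \<in> \<real>\<^sub>\<ge>\<^sub>0"
  shows "psd M"
  using assms[OF psd_outer] by (simp add: psd_def trace_mult_outer)

subsection \<open>Composite systems\<close>

text \<open>Bob's indices label the blocks, so that each block is an operator on Alice's system,
  where the channels act.\<close>

definition block :: "('a::finite \<times> 'b::finite) operator \<Rightarrow> 'b \<Rightarrow> 'b \<Rightarrow> 'a operator" where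
  "block P b c = (\<chi> i j. P $ (i, b) $ (j, c))"

definition slice :: "complex ^ ('a::finite \<times> 'b::finite) \<Rightarrow> 'b \<Rightarrow> complex ^ 'a" where
  "slice w b = (\<chi> i. w $ (i, b))"

text \<open>This is \<open>W\<close> \<otimes> id, the identity acting on Bob's system.\<close>

definition ampl :: "'a::finite superop \<Rightarrow> ('a \<times> 'b::finite) superop" where
  "ampl W P = (\<chi> p q. W (block P (snd p) (snd q)) $ fst p $ fst q)"

lemma sum_UNIV_prod:
  "(\<Sum>p\<in>UNIV. f p) = (\<Sum>b\<in>UNIV. \<Sum>a\<in>UNIV. f (a :: 'a::finite, b :: 'b::finite))"
  by (subst sum.swap) (simp add: sum.cartesian_product)

lemma sesq_blocks:
  "sesq v P w = (\<Sum>b\<in>UNIV. \<Sum>c\<in>UNIV. sesq (slice v b) (block P b c) (slice w c))"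
  unfolding sesq_def sum_UNIV_prod block_def slice_def
  by (intro sum.cong refl) (subst sum.swap, simp)

lemma trace_mult_blocks:
  "trace (P ** Q) = (\<Sum>b\<in>UNIV. \<Sum>c\<in>UNIV. trace (block P b c ** block Q c b))"
  unfolding trace_mult sum_UNIV_prod block_def
  by (intro sum.cong refl) (subst sum.swap, simp)

lemma block_ampl: "block (ampl W P) b c = W (block P b c)"
  by (simp add: block_def ampl_def vec_eq_iff)

lemma block_kron: "block (kron A B) b c = cscale (B $ b $ c) A"
  by (simp add: block_def kron_def cscale_def vec_eq_iff)

lemma kron_cscale: "kron A B $ p $ q = cscale (B $ snd p $ snd q) A $ fst p $ fst q"
  by (simp add: kron_def cscale_def)

lemma ampl_kron:
  assumes "clinear_map W"
  shows "ampl W (kron A B) = kron (W A) B"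
  using assms by (simp add: vec_eq_iff ampl_def block_kron kron_cscale clinear_map_def)

lemma kron_mat_1: "kron (mat 1) (mat 1) = mat 1"
  by (simp add: kron_def mat_def vec_eq_iff prod_eq_iff)

text \<open>The trace pairing splits over blocks and is symmetric, so \<open>heis W\<close> serves
  equally as the predual of a Heisenberg map \<open>W\<close>.\<close>

lemma trace_ampl:
  assumes "clinear_map W"
  shows "trace (ampl W P ** R) = trace (P ** ampl (heis W) R)"
proof -
  have "trace (W X ** Y) = trace (X ** heis W Y)" for X Y
    using heis_trace[OF assms, of Y X] trace_mul_sym[of "W X" Y] trace_mul_sym[of X "heis W Y"]
    by simp
  then show ?thesis
    unfolding trace_mult_blocks block_ampl by simp
qed

lemma psd_ampl:
  fixes P :: "('a::finite \<times> 'b::finite) operator"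
  assumes W: "completely_positive W" and P: "psd P"
  shows "psd (ampl W P)"
proof -
  \<comment> \<open>Complete positivity refers to numbered blocks, so Bob's basis is
    enumerated.\<close>
  obtain f :: "nat \<Rightarrow> 'b" where f: "bij_betw f {..<CARD('b)} UNIV"
    using ex_bij_betw_nat_finite[of "UNIV :: 'b set"] by (auto simp: atLeast0LessThan)
  let ?g = "inv_into {..<CARD('b)} f"
  have reindex: "(\<Sum>b\<in>UNIV. \<Sum>c\<in>UNIV. h b c) = (\<Sum>i<CARD('b). \<Sum>j<CARD('b). h (f i) (f j))"
    for h :: "'b \<Rightarrow> 'b \<Rightarrow> complex"
    by (simp add: sum.reindex_bij_betw[OF f, symmetric])
  have "block_psd CARD('b) (\<lambda>i j. block P (f i) (f j))"
    unfolding block_psd_def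
  proof
    fix v :: "nat \<Rightarrow> complex ^ 'a"
    \<comment> \<open>The block vector \<open>v\<close> reassembled into one vector, whose slice at
      \<open>f i\<close> is \<open>v i\<close>.\<close>
    define w :: "complex ^ ('a \<times> 'b)" where "w = (\<chi> p. v (?g (snd p)) $ fst p)"
    have "slice w (f i) = v i" if "i < CARD('b)" for i
      using that f by (simp add: slice_def w_def vec_eq_iff bij_betw_def)
    then have "sesq w P w = (\<Sum>i<CARD('b). \<Sum>j<CARD('b). sesq (v i) (block P (f i) (f j)) (v j))"
      unfolding sesq_blocks reindex by simp
    then show "(\<Sum>i<CARD('b). \<Sum>j<CARD('b). sesq (v i) (block P (f i) (f j)) (v j)) \<in> \<real>\<^sub>\<ge>\<^sub>0"
      using P unfolding psd_def by metis
  qed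
  then have "block_psd CARD('b) (\<lambda>i j. W (block P (f i) (f j)))"
    using W by (simp add: completely_positive_def)
  then show ?thesis
    unfolding psd_def sesq_blocks block_ampl reindex by (simp add: block_psd_def)
qed

text \<open>Self-duality transfers positivity from \<open>ampl W\<close> to its trace
  adjoint.\<close>

lemma psd_ampl_heis:
  assumes "completely_positive W" "psd P"
  shows "psd (ampl (heis W) P)"
proof (rule psd_dual)
  fix N :: "('a \<times> 'b) operator"
  assume "psd N"
  then have "trace (ampl W N ** P) \<in> \<real>\<^sub>\<ge>\<^sub>0"
    using assms by (intro trace_mult_psd psd_ampl)
  then show "trace (ampl (heis W) P ** N) \<in> \<real>\<^sub>\<ge>\<^sub>0"
    using assms(1) by (metis trace_ampl completely_positive_def trace_mul_sym)
qed

lemma psd_kron: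
  assumes "psd A" "psd B"
  shows "psd (kron A B)"
  using assms(1)
proof (induction A rule: psd_induct)
  case zero
  then show ?case by (simp add: psd_def sesq_def kron_def)
next
  case (add A v)
  have "psd (kron (outer v) B)"
    unfolding psd_def
  proof
    fix w :: "complex ^ ('a \<times> 'b)"
    \<comment> \<open>The partial inner product of \<open>v\<close> with \<open>w\<close> over
      Alice's index; it reduces the form of the product to that of \<open>B\<close>.\<close>
    define u :: "complex ^ 'b" where "u = (\<chi> b. \<Sum>i\<in>UNIV. cnj (v $ i) * slice w b $ i)"
    have c: "sesq x (cscale z X) y = z * sesq x X y" for x y z and X :: "'a operator"
      by (simp add: sesq_def cscale_def sum_distrib_left mult_ac)
    have "sesq w (kron (outer v) B) w = sesq u B u"
      unfolding sesq_blocks block_kron c sesq_outer by (simp add: sesq_def u_def mult_ac)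
    then show "sesq w (kron (outer v) B) w \<in> \<real>\<^sub>\<ge>\<^sub>0"
      using assms(2) by (simp add: psd_def)
  qed
  moreover have "kron (A + outer v) B = kron A B + kron (outer v) B"
    by (simp add: kron_def vec_eq_iff distrib_right)
  ultimately show ?case
    using add by (simp add: psd_add)
qed

subsection \<open>Measurements and correlations\<close>

text \<open>The four terms from the POVM elements are joint outcome probabilities: nonnegative with
  sum 1. The correlation is their signed sum.\<close>

lemma cmod_correl_le_1:
  assumes "binary_measurement A" "binary_measurement B" "density \<rho>"
  shows "cmod (correl A B \<rho>) \<le> 1"
proof -
  obtain P Q where A: "psd P" "psd Q" "P + Q = mat 1" "A = P - Q"
    using assms(1) unfolding binary_measurement_def by blast
  obtain R S where B: "psd R" "psd S" "R + S = mat 1" "B = R - S"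
    using assms(2) unfolding binary_measurement_def by blast
  have n: "cmod (correl X Y \<rho>) = Re (correl X Y \<rho>)" if "psd X" "psd Y" for X Y
  proof -
    have "correl X Y \<rho> \<in> \<real>\<^sub>\<ge>\<^sub>0"
      using assms(3) psd_kron[OF that] by (simp add: correl_def density_def trace_mult_psd)
    then show ?thesis
      by (auto elim!: nonneg_Reals_cases)
  qed
  have tri: "cmod (p - q - r + s) \<le> cmod p + cmod q + cmod r + cmod s" for p q r s
    by norm
  have "correl A B \<rho> = correl P R \<rho> - correl P S \<rho> - correl Q R \<rho> + correl Q S \<rho>"
    by (simp add: A B correl_def trace_mult kron_def algebra_simps sum.distrib sum_subtractf)
  then have "cmod (correl A B \<rho>)
      \<le> cmod (correl P R \<rho>) + cmod (correl P S \<rho>) + cmod (correl Q R \<rho>) + cmod (correl Q S \<rho>)"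
    using tri by simp
  also have "\<dots> = Re (correl P R \<rho> + correl P S \<rho> + correl Q R \<rho> + correl Q S \<rho>)"
    using A B by (simp add: n)
  also have "correl P R \<rho> + correl P S \<rho> + correl Q R \<rho> + correl Q S \<rho> = correl (P + Q) (R + S) \<rho>"
    by (simp add: correl_def trace_mult kron_def algebra_simps sum.distrib)
  also have "\<dots> = 1"
    using assms(3) unfolding A B by (simp add: correl_def kron_mat_1 density_def)
  finally show ?thesis by simp
qed

text \<open>The algebraic bound serves to make the set of values under the supremum bounded.\<close>

lemma chsh_le_4:
  assumes "binary_measurement A" "binary_measurement A'" "binary_measurement B"
    "binary_measurement B'" "density \<rho>"
  shows "chsh A A' B B' \<rho> \<le> 4"
proof -
  have "chsh A A' B B' \<rho> \<le>
      cmod (correl A B \<rho>) + cmod (correl A B' \<rho>) + cmod (correl A' B \<rho>) + cmod (correl A' B' \<rho>)"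
    unfolding chsh_def by norm
  also have "\<dots> \<le> 1 + 1 + 1 + 1"
    using assms by (intro add_mono cmod_correl_le_1)
  finally show ?thesis by simp
qed

section \<open>Channels in the Heisenberg picture\<close>

lemma psd_superop:
  assumes "completely_positive \<Lambda>" "psd X"
  shows "psd (\<Lambda> X)"
proof -
  \<comment> \<open>Plain positivity is complete positivity with a one-dimensional ancilla.\<close>
  have "block_psd 1 (\<lambda>i j. X)"
    using assms(2) by (simp add: block_psd_def psd_def)
  then have "block_psd 1 (\<lambda>i j. \<Lambda> X)"
    using assms(1) unfolding completely_positive_def by blast
  then have q: "sesq (v 0) (\<Lambda> X) (v 0) \<in> \<real>\<^sub>\<ge>\<^sub>0" for v :: "nat \<Rightarrow> complex ^ 'a"
    by (simp add: block_psd_def)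
  show ?thesis
    using q[of "\<lambda>_. _"] by (simp add: psd_def)
qed

lemma heis_unital:
  assumes "cptp \<Lambda>"
  shows "heis \<Lambda> (mat 1) = mat 1"
  using assms
  by (intro trace_mult_eqD) (simp add: heis_trace cptp_def completely_positive_def trace_preserving_def)

lemma binary_measurement_heis:
  assumes \<Lambda>: "cptp \<Lambda>" and "binary_measurement A"
  shows "binary_measurement (heis \<Lambda> A)"
proof -
  obtain P Q where A: "psd P" "psd Q" "P + Q = mat 1" "A = P - Q"
    using assms(2) unfolding binary_measurement_def by blast
  have cl: "clinear_map \<Lambda>"
    using \<Lambda> by (simp add: cptp_def completely_positive_def)
  have add: "heis \<Lambda> (X + Y) = heis \<Lambda> X + heis \<Lambda> Y" for X Y
    using clinear_map_heis[OF cl] by (simp add: clinear_map_def)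
  have pos: "psd (heis \<Lambda> X)" if "psd X" for X
  proof (rule psd_dual)
    fix N :: "'a operator"
    assume "psd N"
    then show "trace (heis \<Lambda> X ** N) \<in> \<real>\<^sub>\<ge>\<^sub>0"
      using \<Lambda> that by (simp add: heis_trace[OF cl] trace_mult_psd psd_superop cptp_def)
  qed
  have "heis \<Lambda> P + heis \<Lambda> Q = mat 1"
    using add[of P Q] by (simp add: A(3) heis_unital[OF \<Lambda>])
  \<comment> \<open>Additivity is applied to \<open>A + Q\<close>, which equals
    \<open>P\<close>.\<close>
  moreover have "heis \<Lambda> A = heis \<Lambda> P - heis \<Lambda> Q"
    using add[of A Q] by (simp add: A(4))
  ultimately show ?thesis
    unfolding binary_measurement_def using pos A(1,2) by blast
qed

lemma heis_comp:
  assumes "clinear_map V" "clinear_map W"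
  shows "heis (V \<circ> W) = heis W \<circ> heis V"
  using assms by (intro ext trace_mult_eqD) (simp add: heis_trace clinear_map_comp)

text \<open>The trace is the pairing with the identity, a product operator that
  \<open>ampl W\<close> fixes because \<open>W\<close> is unital; hence the predual preserves the
  trace.\<close>

lemma density_ampl_heis:
  assumes W: "completely_positive W" and 1: "W (mat 1) = mat 1" and \<rho>: "density \<rho>"
  shows "density (ampl (heis W) \<rho>)"
proof -
  have cl: "clinear_map W"
    using W by (simp add: completely_positive_def)
  have "trace (ampl (heis W) \<rho>) = trace (ampl W (kron (mat 1) (mat 1)) ** \<rho>)"
    by (simp add: trace_ampl[OF cl] kron_mat_1)
  also have "\<dots> = 1"
    using \<rho> unfolding ampl_kron[OF cl] 1 by (simp add: kron_mat_1 density_def)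
  finally show ?thesis
    using psd_ampl_heis[OF W, of \<rho>] \<rho> by (simp add: density_def)
qed

text \<open>On product operators \<open>ampl W\<close> acts on Alice's factor alone, so the trace
  adjoint moves \<open>W\<close> from her observables to the state.\<close>

lemma chsh_ampl_heis:
  assumes "clinear_map W"
  shows "chsh (W A) (W A') B B' \<rho> = chsh A A' B B' (ampl (heis W) \<rho>)"
  using assms by (simp add: chsh_def correl_def trace_ampl flip: ampl_kron)

text \<open>Absorption gives inclusion of the sets of attainable values. Bob's measurements stay the
  same; only Alice's measurements and the state may change.\<close>

lemma chsh_opt_mono:
  fixes \<Lambda> \<Lambda>' :: "'a::finite superop"
  assumes "cptp \<Lambda>"
    and absorb: "\<And>A A' (B :: 'b::finite operator) B' \<rho>. \<lbrakk>binary_measurement A; binary_measurement A';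
      binary_measurement B; binary_measurement B'; density \<rho>\<rbrakk> \<Longrightarrow>
      \<exists>C C' \<sigma>. binary_measurement C \<and> binary_measurement C' \<and> density \<sigma> \<and>
        chsh (heis \<Lambda>' A) (heis \<Lambda>' A') B B' \<rho> = chsh (heis \<Lambda> C) (heis \<Lambda> C') B B' \<sigma>"
  shows "chsh_opt TYPE('b) \<Lambda>' \<le> chsh_opt TYPE('b) \<Lambda>"
proof -
  let ?S = "\<lambda>\<Lambda>. {chsh (heis \<Lambda> A) (heis \<Lambda> A') B B' \<rho> | A A' (B :: 'b operator) B' \<rho>.
     binary_measurement A \<and> binary_measurement A' \<and>
     binary_measurement B \<and> binary_measurement B' \<and> density \<rho>}"
  have sub: "?S \<Lambda>' \<subseteq> ?S \<Lambda>"
  proof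
    fix x
    assume "x \<in> ?S \<Lambda>'"
    then obtain A A' and B B' :: "'b operator" and \<rho> where x: "x = chsh (heis \<Lambda>' A) (heis \<Lambda>' A') B B' \<rho>"
      and m: "binary_measurement A" "binary_measurement A'" "binary_measurement B"
        "binary_measurement B'" "density \<rho>"
      by blast
    from absorb[OF m] m(3,4) show "x \<in> ?S \<Lambda>"
      unfolding x by blast
  qed
  have "bdd_above (?S \<Lambda>)"
    using assms(1) by (intro bdd_aboveI[of _ 4]) (auto intro!: chsh_le_4 binary_measurement_heis)
  \<comment> \<open>Whether admissible measurements and states exist does not depend on the channel,
    so in the empty case both suprema are the same \<open>Sup {}\<close>.\<close>
  moreover have "?S \<Lambda> = {}" if empty: "?S \<Lambda>' = {}"
  proof (rule equals0I)
    fix x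
    assume "x \<in> ?S \<Lambda>"
    then obtain A A' :: "'a operator" and B B' :: "'b operator" and \<rho> :: "('a \<times> 'b) operator" where
      "binary_measurement A" "binary_measurement A'" "binary_measurement B"
        "binary_measurement B'" "density \<rho>"
      by blast
    then have "chsh (heis \<Lambda>' A) (heis \<Lambda>' A') B B' \<rho> \<in> ?S \<Lambda>'"
      by blast
    then show False
      unfolding empty by (rule emptyE)
  qed
  ultimately show ?thesis
    unfolding chsh_opt_def using sub cSup_subset_mono[of "?S \<Lambda>'" "?S \<Lambda>"]
    by (cases "?S \<Lambda>' = {}") (simp only: order_refl, blast)
qed

theorem theorem1:
  fixes \<Phi> :: "real \<Rightarrow> 'a::finite superop"
    and T :: "real set"
    and s t :: real
  assumes channels: "\<And>\<tau>. \<tau> \<in> T \<Longrightarrow> cptp (\<Phi> \<tau>)"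
    and times: "s \<in> T" "t \<in> T" "s \<le> t"
    and propagator_cp:
      "(\<exists>V. schroedinger_propagator \<Phi> t s V \<and> completely_positive V) \<or>
       (\<exists>W. heisenberg_propagator \<Phi> t s W \<and> completely_positive W)"
  shows "chsh_opt TYPE('b::finite) (\<Phi> t) \<le> chsh_opt TYPE('b) (\<Phi> s)"
  using propagator_cp
proof (elim disjE exE conjE)
  fix V
  assume V: "schroedinger_propagator \<Phi> t s V" "completely_positive V"
  \<comment> \<open>Trace preservation of \<open>V\<close> is part of the propagator notion, and
    taking adjoints reverses composition.\<close>
  then have "cptp V" and "heis (\<Phi> t) = heis (\<Phi> s) \<circ> heis V"
    using channels[OF times(1)]
    by (auto simp: schroedinger_propagator_def cptp_def completely_positive_def heis_comp)
  \<comment> \<open>Witnesses for absorption: Alice measures \<open>heis V A\<close> and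
    \<open>heis V A'\<close>, on the unchanged state.\<close>
  then show ?thesis
    by (intro chsh_opt_mono channels times) (metis comp_apply binary_measurement_heis)
next
  fix W
  assume W: "heisenberg_propagator \<Phi> t s W" "completely_positive W"
  then have cl: "clinear_map W" and eq: "heis (\<Phi> t) = W \<circ> heis (\<Phi> s)"
    by (auto simp: heisenberg_propagator_def)
  \<comment> \<open>Both Heisenberg channels fix the identity, and \<open>W\<close> carries the
    image at \<open>s\<close> to the image at \<open>t\<close>.\<close>
  have "W (mat 1) = mat 1"
    using eq heis_unital channels times by (metis comp_apply)
  \<comment> \<open>Witnesses for absorption: the same measurements, on the state
    \<open>ampl (heis W) \<rho>\<close>.\<close>
  then show ?thesis
    using W(2) unfolding eq
    by (intro chsh_opt_mono channels times)
      (metis eq comp_apply density_ampl_heis chsh_ampl_heis[OF cl])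
qed

end
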